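(* Let $E$ be the Polish space of continuous functions $z:[0,1]\to\mathbb R^d$ with the metric $\rho(z,\tilde z)=\sup_{t\in[0,1]}\|z_t-\tilde z_t\|$, and $\mathcal B(E)$ its Borel $\sigma$-algebra. For any $(E,\mathcal B(E))$-valued random elements $X,\widetilde X$, any measurable function $\varphi:(E,\mathcal B(E))\to(\mathbb R,\mathcal B(\mathbb R))$, and any $p,q,r\in[1,+\infty)$ such that $1/q+1/r=1$, $$\sup_{c\in\mathbb R}\big|\mathbb P[\varphi(\widetilde X)\le c]-\mathbb P[\varphi(X)\le c]\big|\le\|\mu-\widetilde\mu\|_{\mathrm{tv}},$$ $$\mathbb E[|\varphi(\widetilde X)|^p]^{1/p}\le\mathbb E[|\varphi(X)|^p]^{1/p}+\|\mu-\widetilde\mu\|_{\mathrm{tv}}^{1/(pq)}\Big\{\mathbb E[|\varphi(X)|^{pr}]^{1/(pr)}+\mathbb E[|\varphi(\widetilde X)|^{pr}]^{1/(pr)}\Big\},$$ where $\mu(A):=\mathbb P[X\in A]$ and $\widetilde\mu(A):=\mathbb P[\widetilde X\in A]$ for $A\in\mathcal B(E)$.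
   Context: Total variation distance: $\|\nu-\nu'\|_{\mathrm{tv}}=\sup_{A}|\nu(A)-\nu'(A)|$, supremum over the measurable sets. Moments may take the value $+\infty$. *)

theory Defs
  imports "HOL-Probability.Probability"
begin

text \<open>
  The paths are represented as functions on the reals that are continuous on the unit interval
  and take the value \<open>undefined\<close> outside it, so that each continuous function on the unit interval
  has exactly one representative.  The boundedness built into \<^const>\<open>cfunspace\<close> is automatic,
  the unit interval being compact.
\<close>
definition path_space :: "(real \<Rightarrow> real^'d) metric" where
  "path_space = cfunspace (top_of_set {0..1}) euclidean_metric"

lemma mspace_path_space:
  "mspace (path_space :: (real \<Rightarrow> real^'d) metric)
     = {z. z \<in> extensional {0..1} \<and> continuous_on {0..1} z}"
  unfolding path_space_def
  by (subst compactin_mspace_cfunspace) auto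

lemma mdist_path_space:
  fixes z z' :: "real \<Rightarrow> real^'d"
  assumes "z \<in> mspace path_space" and "z' \<in> mspace path_space"
  shows "mdist path_space z z' = (SUP t\<in>{0..1}. norm (z t - z' t))"
proof -
  have "z \<in> Met_TC.fspace {0..1}" "z' \<in> Met_TC.fspace {0..1}"
    using assms cfunspace_subset_funspace[of "top_of_set {0..1::real}" "euclidean_metric :: (real^'d) metric"]
    unfolding path_space_def by (auto simp del: mspace_cfunspace)
  then show ?thesis
    unfolding path_space_def mdist_cfunspace_eq_mdist_funspace
    by (simp add: Met_TC.fdist_def dist_norm)
qed

definition path_borel :: "(real \<Rightarrow> real^'d) measure" where
  "path_borel = sigma (mspace path_space) {U. openin (mtopology_of path_space) U}"

text \<open>For finite measures on a common \<open>\<sigma>\<close>-algebra; the supremum is then over a bounded set.\<close>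
definition tv_dist :: "'a measure \<Rightarrow> 'a measure \<Rightarrow> real" where
  "tv_dist \<nu> \<nu>' = (SUP A\<in>sets \<nu>. \<bar>measure \<nu> A - measure \<nu>' A\<bar>)"

text \<open>
  Powers with positive real exponent \<open>a\<close> of numbers in \<open>[0, \<infinity>]\<close> (for \<open>a \<le> 0\<close> the value
  at \<open>\<infinity>\<close> is not the usual one).
\<close>
definition ennreal_powr :: "ennreal \<Rightarrow> real \<Rightarrow> ennreal" where
  "ennreal_powr x a = (if x = \<infinity> then \<infinity> else ennreal (enn2real x powr a))"

end

theory Submission
  imports Defs
begin

text \<open>
  Let \<open>Y\<close> be a Hahn set of the signed measure \<open>\<mu>' - \<mu>\<close>. Off \<open>Y\<close> the integral of \<open>f = |\<phi>|\<^sup>p\<close> decreases when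
  passing from \<open>\<mu>\<close> to \<open>\<mu>'\<close>. On \<open>Y\<close> one has \<open>f \<le> c f\<^sup>r + d\<close> by Young's inequality, and since
  \<open>c f\<^sup>r + d - f\<close> is nonnegative its integral increases, so that \<open>\<integral> f\<close> grows by at most
  \<open>c \<integral> f\<^sup>r \<partial>\<mu>' + d \<parallel>\<mu> - \<mu>'\<parallel>\<close>. Optimising over the tangent point gives a Hoelder-type bound without any
  density, and subadditivity of the power \<open>1/p\<close> finishes the proof.
\<close>

section \<open>Powers on the reals and on [0, \<infinity>], and Young's inequality\<close>

lemma powr_add_le:
  fixes a b s :: real
  assumes "0 \<le> a" "0 \<le> b" "0 < s" "s \<le> 1"
  shows "(a + b) powr s \<le> a powr s + b powr s"
proof (cases "a + b = 0")
  case False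
  then have pos: "0 < a + b"
    using assms by linarith
  \<comment> \<open>Dividing by \<open>a + b\<close> brings both summands into [0, 1], where
    lowering the exponent from 1 to \<open>s\<close> does not decrease a power.\<close>
  have *: "x / (a + b) \<le> (x / (a + b)) powr s" if "0 \<le> x" "x \<le> a + b" for x
  proof (cases "x = 0")
    case False
    then show ?thesis
      using powr_mono'[of s 1 "x / (a + b)"] that pos assms by simp
  qed simp
  have "1 = a / (a + b) + b / (a + b)"
    using pos by (simp flip: add_divide_distrib)
  also have "\<dots> \<le> (a / (a + b)) powr s + (b / (a + b)) powr s"
    using * assms by (intro add_mono) auto
  also have "\<dots> = (a powr s + b powr s) / (a + b) powr s"
    using pos assms by (simp add: powr_divide add_divide_distrib)
  finally show ?thesis
    using pos by (simp add: field_simps)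
qed (use assms in auto)

lemma ennreal_powr_top [simp]: "ennreal_powr \<infinity> s = \<infinity>" "ennreal_powr top s = top"
  by (simp_all add: ennreal_powr_def)

lemma ennreal_powr_ennreal [simp]: "0 \<le> x \<Longrightarrow> ennreal_powr (ennreal x) s = ennreal (x powr s)"
  by (simp add: ennreal_powr_def)

lemma ennreal_powr_mono:
  assumes "x \<le> y" "0 \<le> s"
  shows "ennreal_powr x s \<le> ennreal_powr y s"
  using assms by (cases x; cases y) (auto intro!: ennreal_leI powr_mono2 simp: top_unique)

lemma ennreal_powr_add_le:
  assumes "0 < s" "s \<le> 1"
  shows "ennreal_powr (x + y) s \<le> ennreal_powr x s + ennreal_powr y s"
  using assms
  by (cases x; cases y) (auto simp: powr_add_le simp flip: ennreal_plus intro!: ennreal_leI)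

lemma ennreal_powr_mult:
  assumes "0 < s"
  shows "ennreal_powr (x * y) s = ennreal_powr x s * ennreal_powr y s"
proof -
  have [simp]: "ennreal_powr 0 s = 0"
    by (simp add: ennreal_powr_def)
  \<comment> \<open>The delicate case is 0 times \<infinity>, which is 0; it is consistent with
    taking powers because \<open>0 powr s\<close> is 0.\<close>
  have top: "ennreal_powr (ennreal z * top) s = ennreal_powr (ennreal z) s * top" if "0 \<le> z" for z
    using that assms by (cases "z = 0") (auto simp: ennreal_mult_top)
  then have top': "ennreal_powr (top * ennreal z) s = top * ennreal_powr (ennreal z) s" if "0 \<le> z" for z
    using that by (simp add: mult.commute)
  show ?thesis
    using top top' by (cases x; cases y) (auto simp: powr_mult simp flip: ennreal_mult)
qed

lemma ennreal_powr_powr: "ennreal_powr (ennreal_powr x s) t = ennreal_powr x (s * t)"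
  by (cases x) (auto simp: powr_powr)

text \<open>Young's inequality for \<open>x / K\<close> and 1, scaled by \<open>K\<close>. In the
  variable u = \<open>x powr r\<close> the right-hand side is the tangent at u =
  \<open>K powr r\<close> of the concave function u to the power 1/r.\<close>

lemma powr_tangent_line:
  fixes x K q r :: real
  assumes "0 \<le> x" "0 < K" "1 < q" "1 < r" "1 / q + 1 / r = 1"
  shows "x \<le> K powr (1 - r) / r * x powr r + K / q"
proof -
  have "x / K \<le> (x / K) powr r / r + 1 / q"
    using Youngs_inequality[of r q "x / K" 1] assms by simp
  then have "K * (x / K) \<le> K * ((x / K) powr r / r + 1 / q)"
    using assms by (intro mult_left_mono) auto
  also have "\<dots> = K powr (1 - r) / r * x powr r + K / q"
    using assms by (simp add: powr_divide powr_diff field_simps)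
  finally show ?thesis
    using assms by simp
qed

section \<open>Integrals under ordered measures\<close>

text \<open>Since \<open>c * u + d - f\<close> is nonnegative, its integral increases with the measure.\<close>
lemma nn_integral_le_of_affine_bound:
  assumes le: "N \<le> N'" and sets: "sets N = sets N'"
    and fin: "emeasure N' (space N') < \<infinity>"
    and mass: "emeasure N' (space N') \<le> emeasure N (space N) + t"
    and meas: "f \<in> borel_measurable N'" "u \<in> borel_measurable N'"
    and bound: "\<And>x. f x \<le> c * u x + d" and d: "d < \<infinity>"
    and f: "\<And>x. f x < \<infinity>"
  shows "(\<integral>\<^sup>+x. f x \<partial>N') \<le> (\<integral>\<^sup>+x. f x \<partial>N) + (c * (\<integral>\<^sup>+x. u x \<partial>N') + d * t)"
proof (cases "c * (\<integral>\<^sup>+x. u x \<partial>N') = top")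
  case False
  note [measurable] = meas
  have [measurable]: "f \<in> borel_measurable N" "u \<in> borel_measurable N"
    using meas by (simp_all add: measurable_cong_sets[OF sets refl])
  \<comment> \<open>Subtraction in [0, \<infinity>] truncates at 0; by \<open>bound\<close> nothing
    is truncated here.\<close>
  define g where "g x = c * u x + d - f x" for x
  have [measurable]: "g \<in> borel_measurable N" "g \<in> borel_measurable N'"
    unfolding g_def by measurable
  have gf: "g x + f x = c * u x + d" for x
    unfolding g_def using bound[of x] f[of x] by (simp add: diff_add_cancel_ennreal)
  have split: "(\<integral>\<^sup>+x. g x \<partial>L) + (\<integral>\<^sup>+x. f x \<partial>L)
      = c * (\<integral>\<^sup>+x. u x \<partial>L) + d * emeasure L (space L)" if "sets L = sets N'" for L
  proof -
    have [measurable]: "f \<in> borel_measurable L" "u \<in> borel_measurable L" "g \<in> borel_measurable L"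
      using meas \<open>g \<in> borel_measurable N'\<close> by (simp_all add: measurable_cong_sets[OF that refl])
    have "(\<integral>\<^sup>+x. g x \<partial>L) + (\<integral>\<^sup>+x. f x \<partial>L) = (\<integral>\<^sup>+x. c * u x + d \<partial>L)"
      by (simp add: gf flip: nn_integral_add)
    then show ?thesis
      by (simp add: nn_integral_add nn_integral_cmult)
  qed
  have mono: "(\<integral>\<^sup>+x. g x \<partial>N) \<le> (\<integral>\<^sup>+x. g x \<partial>N')"
    by (rule nn_integral_mono_measure[OF sets le])
  \<comment> \<open>The argument stays additive; finiteness of the integral of \<open>g\<close>
    under \<open>N\<close> is what allows cancelling it at the end.\<close>
  have "(\<integral>\<^sup>+x. g x \<partial>N') \<le> c * (\<integral>\<^sup>+x. u x \<partial>N') + d * emeasure N' (space N')"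
    using split[of N'] by (metis le_iff_add)
  also have "\<dots> < top"
    using False fin d by (simp add: ennreal_mult_less_top less_top)
  finally have gfin: "(\<integral>\<^sup>+x. g x \<partial>N) \<noteq> top"
    using mono by auto
  have "(\<integral>\<^sup>+x. g x \<partial>N) + (\<integral>\<^sup>+x. f x \<partial>N')
      \<le> c * (\<integral>\<^sup>+x. u x \<partial>N') + d * emeasure N' (space N')"
    using mono split[of N'] by (metis add_right_mono)
  \<comment> \<open>Trading the mass of \<open>N'\<close> for that of \<open>N\<close> plus
    \<open>t\<close> lets \<open>split\<close> be applied to \<open>N\<close>, so that only
    \<open>d * t\<close> remains of the constant term.\<close>
  also have "\<dots> \<le> c * (\<integral>\<^sup>+x. u x \<partial>N') + d * (emeasure N (space N) + t)"
    using mass by (intro add_left_mono mult_left_mono) auto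
  also have "\<dots> = (c * (\<integral>\<^sup>+x. u x \<partial>N') + d * t) + d * emeasure N (space N)"
    by (simp add: distrib_left ac_simps)
  also have "\<dots> \<le> (c * (\<integral>\<^sup>+x. u x \<partial>N') + d * t)
      + ((\<integral>\<^sup>+x. g x \<partial>N) + (\<integral>\<^sup>+x. f x \<partial>N))"
    unfolding split[OF sets] by (intro add_left_mono) simp
  also have "\<dots> = (\<integral>\<^sup>+x. g x \<partial>N)
      + ((\<integral>\<^sup>+x. f x \<partial>N) + (c * (\<integral>\<^sup>+x. u x \<partial>N') + d * t))"
    by (simp add: ac_simps)
  finally show ?thesis
    using gfin by (simp add: ennreal_add_left_cancel_le)
qed simp

section \<open>Comparison of integrals through total variation\<close>

lemma abs_measure_diff_le_tv_dist:
  assumes "prob_space N" "prob_space N'" "A \<in> sets N"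
  shows "\<bar>measure N A - measure N' A\<bar> \<le> tv_dist N N'"
  unfolding tv_dist_def
proof (rule cSUP_upper[OF assms(3)])
  show "bdd_above ((\<lambda>A. \<bar>measure N A - measure N' A\<bar>) ` sets N)"
    using prob_space.prob_le_1[OF assms(1)] prob_space.prob_le_1[OF assms(2)]
    by (intro bdd_aboveI2[where M = 1])
      (smt (verit) measure_nonneg)
qed

lemma tv_dist_nonneg:
  assumes "prob_space N" "prob_space N'"
  shows "0 \<le> tv_dist N N'"
  using abs_measure_diff_le_tv_dist[OF assms sets.empty_sets] by simp

lemma nn_integral_le_affine_tv_dist:
  assumes N: "prob_space N" and N': "prob_space N'" and sets [simp]: "sets N = sets N'"
    and meas [measurable]: "f \<in> borel_measurable N'" "u \<in> borel_measurable N'"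
    and bound: "\<And>x. f x \<le> c * u x + d" and d: "d < \<infinity>"
    and f: "\<And>x. f x < \<infinity>"
  shows "(\<integral>\<^sup>+x. f x \<partial>N')
    \<le> (\<integral>\<^sup>+x. f x \<partial>N) + (c * (\<integral>\<^sup>+x. u x \<partial>N') + d * ennreal (tv_dist N N'))"
proof -
  interpret N: prob_space N by fact
  interpret N': prob_space N' by fact
  obtain Y where Y [measurable]: "Y \<in> sets N'"
    and up: "\<And>A. A \<in> sets N' \<Longrightarrow> A \<subseteq> Y \<Longrightarrow> emeasure N A \<le> emeasure N' A"
    and down: "\<And>A. A \<in> sets N' \<Longrightarrow> A \<inter> Y = {} \<Longrightarrow> emeasure N' A \<le> emeasure N A"
    using finite_unsigned_Hahn_decomposition[OF N'.finite_measure_axioms N.finite_measure_axioms]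
    by auto
  have [simp]: "space N = space N'"
    by (rule sets_eq_imp_space_eq) simp
  define Z where "Z = space N' - Y"
  have Z [measurable]: "Z \<in> sets N'"
    unfolding Z_def by measurable
  have [measurable]: "f \<in> borel_measurable N" "Y \<in> sets N" "Z \<in> sets N" "u \<in> borel_measurable N"
    using meas by (simp_all add: measurable_cong_sets[OF sets refl])
  \<comment> \<open>Restriction to \<open>B\<close> is encoded as a density, which keeps the
    \<sigma>-algebra; the order on measures then amounts to comparing the values on all subsets of
    \<open>B\<close>.\<close>
  have mono: "density L (indicator B) \<le> density L' (indicator B)"
    if "sets L = sets L'" "B \<in> sets L'"
      and "\<And>A. A \<in> sets L' \<Longrightarrow> A \<subseteq> B \<Longrightarrow> emeasure L A \<le> emeasure L' A"
    for L L' :: "'a measure" and B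
    using that by (simp add: le_measure emeasure_density nn_integral_indicator
        flip: indicator_inter_arith)
  have split: "(\<integral>\<^sup>+x. f x \<partial>L)
      = (\<integral>\<^sup>+x. f x \<partial>density L (indicator Y)) + (\<integral>\<^sup>+x. f x \<partial>density L (indicator Z))"
    if L: "sets L = sets N'" for L
  proof -
    have sp: "space L = space N'"
      using L by (rule sets_eq_imp_space_eq)
    have [measurable]: "f \<in> borel_measurable L" "Y \<in> sets L" "Z \<in> sets L"
      using L meas by (simp_all add: measurable_cong_sets[OF L refl])
    have "(\<integral>\<^sup>+x. f x \<partial>L) = (\<integral>\<^sup>+x. indicator Y x * f x + indicator Z x * f x \<partial>L)"
      by (intro nn_integral_cong) (auto simp: sp Z_def indicator_def)
    then show ?thesis
      by (simp add: nn_integral_add nn_integral_density)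
  qed
  have Zle: "(\<integral>\<^sup>+x. f x \<partial>density N' (indicator Z)) \<le> (\<integral>\<^sup>+x. f x \<partial>density N (indicator Z))"
    using down by (intro nn_integral_mono_measure mono) (auto simp: Z_def)
  \<comment> \<open>\<open>Y\<close> itself is the test set that bounds the excess mass.\<close>
  have "emeasure N' Y \<le> emeasure N Y + ennreal (tv_dist N N')"
    using abs_measure_diff_le_tv_dist[OF N N', of Y]
    by (simp add: N.emeasure_eq_measure N'.emeasure_eq_measure flip: ennreal_plus)
  moreover have "emeasure (density L (indicator Y)) (space N') = emeasure L Y"
    if L: "sets L = sets N'" for L
  proof -
    have "Y \<in> sets L" "space L = space N'"
      using L Y by (auto dest: sets_eq_imp_space_eq)
    moreover from this have "Y \<inter> space N' = Y"
      by (metis sets.Int_space_eq2)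
    ultimately show ?thesis
      using sets.top[of L] by (simp add: emeasure_density flip: indicator_inter_arith)
  qed
  ultimately have "(\<integral>\<^sup>+x. f x \<partial>density N' (indicator Y))
    \<le> (\<integral>\<^sup>+x. f x \<partial>density N (indicator Y))
      + (c * (\<integral>\<^sup>+x. u x \<partial>density N' (indicator Y)) + d * ennreal (tv_dist N N'))"
    by (intro nn_integral_le_of_affine_bound mono bound d f up) (simp_all add: less_top[symmetric])
  also have "\<dots> \<le> (\<integral>\<^sup>+x. f x \<partial>density N (indicator Y))
      + (c * (\<integral>\<^sup>+x. u x \<partial>N') + d * ennreal (tv_dist N N'))"
    by (intro add_mono mult_left_mono order_refl)
      (simp_all add: nn_integral_density nn_integral_mono indicator_def)
  finally show ?thesis
    unfolding split[OF refl] split[OF sets]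
    by (rule order_trans[OF add_mono[OF _ Zle]]) (simp add: ac_simps)
qed

text \<open>Settles the degenerate case in which the optimal tangent point would require division by
  a zero distance.\<close>

lemma measure_eqI_tv_dist_0:
  assumes "prob_space N" "prob_space N'" "sets N = sets N'" "tv_dist N N' = 0"
  shows "N = N'"
proof (rule measure_eqI[OF assms(3)])
  interpret N: prob_space N by fact
  interpret N': prob_space N' by fact
  show "emeasure N A = emeasure N' A" if "A \<in> sets N" for A
    using abs_measure_diff_le_tv_dist[OF assms(1,2) that] assms(4)
    by (simp add: N.emeasure_eq_measure N'.emeasure_eq_measure)
qed

text \<open>The affine bounds for all \<open>K\<close> hold simultaneously, so the best one may be
  chosen from the \<open>r\<close>-th moment under \<open>N'\<close> and the distance. No moment of
  order \<open>r\<close> under \<open>N\<close> enters.\<close>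

lemma nn_integral_le_tv_dist:
  fixes f :: "'a \<Rightarrow> real" and q r :: real
  assumes N: "prob_space N" and N': "prob_space N'" and sets: "sets N = sets N'"
    and meas [measurable]: "f \<in> borel_measurable N'" and nonneg: "\<And>x. 0 \<le> f x"
    and qr: "1 < q" "1 < r" "1 / q + 1 / r = 1"
  shows "(\<integral>\<^sup>+x. f x \<partial>N')
    \<le> (\<integral>\<^sup>+x. f x \<partial>N)
      + ennreal (tv_dist N N' powr (1 / q)) * ennreal_powr (\<integral>\<^sup>+x. f x powr r \<partial>N') (1 / r)"
proof (cases "tv_dist N N' = 0")
  \<comment> \<open>The last summand is now 0, even for an infinite moment, so the claim rests on
    equality of the two measures.\<close>
  case True
  then show ?thesis
    using measure_eqI_tv_dist_0[OF N N' sets] by simp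
next
  case False
  define t where "t = tv_dist N N'"
  have t: "0 < t"
    using False tv_dist_nonneg[OF N N'] by (simp add: t_def)
  show ?thesis
  proof (cases "\<integral>\<^sup>+x. f x powr r \<partial>N'")
    case (real B)
    show ?thesis
    proof (cases "B = 0")
      \<comment> \<open>No positive tangent point is optimal here, but \<open>f\<close> vanishes
        almost everywhere under \<open>N'\<close>, and so does the left-hand side.\<close>
      case True
      then have "AE x in N'. ennreal (f x powr r) = 0"
        using real by (subst nn_integral_0_iff_AE[symmetric]) auto
      then have "AE x in N'. ennreal (f x) = 0"
        by eventually_elim (use nonneg in \<open>auto simp: ennreal_eq_0_iff\<close>)
      then show ?thesis
        by (simp add: nn_integral_cong_AE)
    next
      case False
      then have B: "0 < B"
        using real by simp
      \<comment> \<open>The tangent point for which the bound is smallest.\<close>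
      define K where "K = (B / t) powr (1 / r)"
      have K: "0 < K"
        using B t by (simp add: K_def)
      have Kr: "K powr r = B / t"
        using B t qr by (simp add: K_def powr_powr)
      have "1 / q = 1 - 1 / r"
        using qr by simp
      then have Kt: "K * t = t powr (1 / q) * B powr (1 / r)"
        using B t by (simp add: K_def powr_divide powr_diff)
      have "(\<integral>\<^sup>+x. f x \<partial>N')
        \<le> (\<integral>\<^sup>+x. f x \<partial>N) + (ennreal (K powr (1 - r) / r) * (\<integral>\<^sup>+x. f x powr r \<partial>N')
            + ennreal (K / q) * ennreal (tv_dist N N'))"
        using K qr nonneg powr_tangent_line[OF nonneg K qr]
        by (intro nn_integral_le_affine_tv_dist N N' sets)
           (auto simp flip: ennreal_mult ennreal_plus intro!: ennreal_leI)
      also have "ennreal (K powr (1 - r) / r) * (\<integral>\<^sup>+x. f x powr r \<partial>N')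
            + ennreal (K / q) * ennreal (tv_dist N N')
          = ennreal (K powr (1 - r) / r * B + K / q * t)"
        using K B t qr
        by (simp add: real flip: ennreal_mult ennreal_plus t_def)
      \<comment> \<open>By \<open>Kr\<close> the first term equals \<open>K * t / r\<close>, so the
        two terms are the shares 1/r and 1/q of \<open>K * t\<close>.\<close>
      also have "K powr (1 - r) / r * B + K / q * t = K * t * (1 / q + 1 / r)"
        using K B t qr(1,2) by (simp add: powr_diff Kr field_simps)
      also have "\<dots> = t powr (1 / q) * B powr (1 / r)"
        using qr(3) Kt by simp
      finally show ?thesis
        using B by (simp add: real t_def ennreal_mult)
    qed
  next
    case top
    then show ?thesis
      using t by (simp add: t_def ennreal_mult_top)
  qed
qed

section \<open>The two bounds for functionals of random paths\<close>

theorem lemma9: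
  fixes M :: "'w measure"
    and X X' :: "'w \<Rightarrow> (real \<Rightarrow> real^'d)"
    and \<phi> :: "(real \<Rightarrow> real^'d) \<Rightarrow> real"
    and p q r :: real
    and \<mu> \<mu>' :: "(real \<Rightarrow> real^'d) measure"
  defines "\<mu> \<equiv> distr M path_borel X"
    and "\<mu>' \<equiv> distr M path_borel X'"
  assumes "prob_space M"
    and "X \<in> M \<rightarrow>\<^sub>M path_borel"
    and "X' \<in> M \<rightarrow>\<^sub>M path_borel"
    and "\<phi> \<in> path_borel \<rightarrow>\<^sub>M borel"
    and "1 \<le> p" and "1 \<le> q" and "1 \<le> r"
    and "1 / q + 1 / r = 1"
  shows "(SUP c. \<bar>\<P>(\<omega> in M. \<phi> (X' \<omega>) \<le> c) - \<P>(\<omega> in M. \<phi> (X \<omega>) \<le> c)\<bar>) \<le> tv_dist \<mu> \<mu>' \<and>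
    ennreal_powr (\<integral>\<^sup>+ \<omega>. ennreal (\<bar>\<phi> (X' \<omega>)\<bar> powr p) \<partial>M) (1 / p)
      \<le> ennreal_powr (\<integral>\<^sup>+ \<omega>. ennreal (\<bar>\<phi> (X \<omega>)\<bar> powr p) \<partial>M) (1 / p)
        + ennreal (tv_dist \<mu> \<mu>' powr (1 / (p * q)))
          * (ennreal_powr (\<integral>\<^sup>+ \<omega>. ennreal (\<bar>\<phi> (X \<omega>)\<bar> powr (p * r)) \<partial>M) (1 / (p * r))
             + ennreal_powr (\<integral>\<^sup>+ \<omega>. ennreal (\<bar>\<phi> (X' \<omega>)\<bar> powr (p * r)) \<partial>M) (1 / (p * r)))"
proof (intro conjI)
  note [measurable] = assms(4-6)
  interpret M: prob_space M by fact
  have N: "prob_space \<mu>" "prob_space \<mu>'"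
    unfolding \<mu>_def \<mu>'_def by (auto intro!: M.prob_space_distr)
  have sets: "sets \<mu> = sets \<mu>'"
    by (simp add: \<mu>_def \<mu>'_def)
  have [measurable]: "\<phi> \<in> borel_measurable \<mu>'"
    by (simp add: \<mu>'_def)
  \<comment> \<open>An exponent 1 would make the reciprocal of the other exponent 0, although that
    exponent is at least 1.\<close>
  have "q \<noteq> 1" "r \<noteq> 1"
    using assms(8-10) by auto
  then have qr: "1 < q" "1 < r"
    using assms(8,9) by auto
  show "(SUP c. \<bar>\<P>(\<omega> in M. \<phi> (X' \<omega>) \<le> c) - \<P>(\<omega> in M. \<phi> (X \<omega>) \<le> c)\<bar>) \<le> tv_dist \<mu> \<mu>'"
  proof (rule cSUP_least)
    fix c
    \<comment> \<open>The sublevel set of \<phi> serves as the test set in the total variation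
      distance.\<close>
    let ?A = "{z \<in> space path_borel. \<phi> z \<le> c}"
    have A [measurable]: "?A \<in> sets path_borel"
      by measurable
    have law: "\<P>(\<omega> in M. \<phi> (V \<omega>) \<le> c) = measure (distr M path_borel V) ?A"
      if [measurable]: "V \<in> M \<rightarrow>\<^sub>M path_borel" for V
      using measurable_space[OF that]
      by (auto simp: measure_distr intro!: arg_cong[where f = "measure M"])
    show "\<bar>\<P>(\<omega> in M. \<phi> (X' \<omega>) \<le> c) - \<P>(\<omega> in M. \<phi> (X \<omega>) \<le> c)\<bar> \<le> tv_dist \<mu> \<mu>'"
      using abs_measure_diff_le_tv_dist[OF N, of ?A]
      by (simp add: law \<mu>_def \<mu>'_def abs_minus_commute)
  qed simp
  define a where "a s V = (\<integral>\<^sup>+ \<omega>. ennreal (\<bar>\<phi> (V \<omega>)\<bar> powr s) \<partial>M)"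
    for s and V :: "'w \<Rightarrow> real \<Rightarrow> real^'d"
  have law: "(\<integral>\<^sup>+z. ennreal (\<bar>\<phi> z\<bar> powr s) \<partial>distr M path_borel V) = a s V"
    if [measurable]: "V \<in> M \<rightarrow>\<^sub>M path_borel" for s V
    by (simp add: nn_integral_distr a_def)
  \<comment> \<open>With f = \<open>\<bar>\<phi> z\<bar> powr p\<close>, the \<open>r\<close>-th
    power of f has exponent \<open>p * r\<close>.\<close>
  have "a p X' \<le> a p X + ennreal (tv_dist \<mu> \<mu>' powr (1 / q)) * ennreal_powr (a (p * r) X') (1 / r)"
    using nn_integral_le_tv_dist[OF N sets _ _ qr assms(10), of "\<lambda>z. \<bar>\<phi> z\<bar> powr p"]
    unfolding \<mu>_def \<mu>'_def by (simp add: law powr_powr)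
  then have "ennreal_powr (a p X') (1 / p) \<le> ennreal_powr (a p X
      + ennreal (tv_dist \<mu> \<mu>' powr (1 / q)) * ennreal_powr (a (p * r) X') (1 / r)) (1 / p)"
    using assms(7) by (intro ennreal_powr_mono) auto
  also have "\<dots> \<le> ennreal_powr (a p X) (1 / p)
      + ennreal_powr (ennreal (tv_dist \<mu> \<mu>' powr (1 / q)) * ennreal_powr (a (p * r) X') (1 / r)) (1 / p)"
    using assms(7) by (intro ennreal_powr_add_le) auto
  also have "\<dots> = ennreal_powr (a p X) (1 / p)
      + ennreal (tv_dist \<mu> \<mu>' powr (1 / (p * q))) * ennreal_powr (a (p * r) X') (1 / (p * r))"
    using assms(7) by (simp add: ennreal_powr_mult ennreal_powr_powr powr_powr mult.commute)
  \<comment> \<open>The moment of order \<open>p * r\<close> of \<open>X\<close> enters only here,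
    as a nonnegative summand.\<close>
  also have "\<dots> \<le> ennreal_powr (a p X) (1 / p) + ennreal (tv_dist \<mu> \<mu>' powr (1 / (p * q)))
      * (ennreal_powr (a (p * r) X) (1 / (p * r)) + ennreal_powr (a (p * r) X') (1 / (p * r)))"
    by (intro add_left_mono mult_left_mono) auto
  finally show "ennreal_powr (\<integral>\<^sup>+ \<omega>. ennreal (\<bar>\<phi> (X' \<omega>)\<bar> powr p) \<partial>M) (1 / p)
      \<le> ennreal_powr (\<integral>\<^sup>+ \<omega>. ennreal (\<bar>\<phi> (X \<omega>)\<bar> powr p) \<partial>M) (1 / p)
        + ennreal (tv_dist \<mu> \<mu>' powr (1 / (p * q)))
          * (ennreal_powr (\<integral>\<^sup>+ \<omega>. ennreal (\<bar>\<phi> (X \<omega>)\<bar> powr (p * r)) \<partial>M) (1 / (p * r))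
             + ennreal_powr (\<integral>\<^sup>+ \<omega>. ennreal (\<bar>\<phi> (X' \<omega>)\<bar> powr (p * r)) \<partial>M) (1 / (p * r)))"
    unfolding a_def .
qed

end
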